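(* The set $choice_*^1$ of Asser axioms is HPL-independent of $AC^{1,1}$: there exist a second-order formula $H$ (with the unary predicate variable $C$ free) and a second-order Henkin–Asser structure that is a model of ${}^hax^{(2)}$ and $AC^{1,1}$ but does not satisfy $choice_*^1(H)$; and there exists a second-order Henkin–Asser structure (the basic Fraenkel model $\Sigma_0$) that is a model of ${}^hax^{(2)}\cup choice_*^1\cup\{AC^{1,1}\}$.
   Context: Work in second-order predicate logic with Henkin interpretation; ${}^hax^{(2)}$ is its axiom system, and a Henkin–Asser structure is a structure $(J_k)_{k\ge0}$ with nonempty individual domain $J_0$ and sets $J_k$ of $k$-ary predicates over which $k$-ary predicate variables range, closed under second-order definability. The basic Fraenkel model of second order is $\Sigma_0=\Sigma(\mathbb{N},\mathfrak{G},{\cal I}_0)$ where $\mathfrak{G}$ is the group of all permutations of $\mathbb{N}$, ${\cal I}_0$ the finite subsets of $\mathbb{N}$, and $J_n$ consists of the $n$-ary predicates on $\mathbb{N}$ fixed by every $\pi\in\mathfrak{G}$ that fixes some finite set pointwise (permutations acting by $(\pi\alpha)(\pi\xi_1,\dots,\pi\xi_n)=\alpha(\xi_1,\dots,\xi_n)$). $\exists!!$ means "there exists exactly one". $AC^{1,1}=\forall A\forall R\exists S(\forall x(Ax\leftrightarrow\exists yRxy)\to\forall x(Ax\to\exists!!y(Rxy\land Sxy)))$ with $A$ unary and $R,S$ binary. $choice_*^{1}(H)=\forall C(H(C)\to\exists yCy)\land\forall C_1\forall C_2(H(C_1)\land H(C_2)\land C_1\neq C_2\to\neg\exists y(C_1y\land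 C_2y))\to\exists D\forall C(H(C)\to\exists!!y(Cy\land Dy))$ with $C,C_1,C_2,D$ unary, $C_1\neq C_2$ abbreviating $\neg\forall y(C_1y\leftrightarrow C_2y)$; $choice_*^1$ is the set of all such formulas for second-order formulas $H$ with $C$ free (possibly with further free variables; "does not satisfy" means false under some assignment). *)

theory Defs
  imports Main
begin

text \<open>
  Individual variables are named by natural numbers.  A predicate variable is named by its
  arity \<open>n \<ge> 1\<close> and a natural number, so \<open>(n, i)\<close> is the \<open>i\<close>-th \<open>n\<close>-ary predicate variable.
  The language is many-sorted with identity on each sort.
\<close>

datatype fm =
    Pred nat nat "nat list"
  | IEq nat nat
  | PEq nat nat nat
  | Neg fm
  | Conj fm fm
  | AllI nat fm
  | AllP nat nat fm

abbreviation Imp :: "fm \<Rightarrow> fm \<Rightarrow> fm" where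
  "Imp p q \<equiv> Neg (Conj p (Neg q))"

abbreviation Iff :: "fm \<Rightarrow> fm \<Rightarrow> fm" where
  "Iff p q \<equiv> Conj (Imp p q) (Imp q p)"

abbreviation ExI :: "nat \<Rightarrow> fm \<Rightarrow> fm" where
  "ExI x p \<equiv> Neg (AllI x (Neg p))"

abbreviation ExP :: "nat \<Rightarrow> nat \<Rightarrow> fm \<Rightarrow> fm" where
  "ExP n i p \<equiv> Neg (AllP n i (Neg p))"

text \<open>\<open>\<exists>!!y p\<close>, written as \<open>\<exists>z \<forall>y (p \<leftrightarrow> y = z)\<close>; the auxiliary variable \<open>z\<close> must differ from \<open>y\<close>
  and must not occur free in \<open>p\<close>.\<close>

abbreviation ExOne :: "nat \<Rightarrow> nat \<Rightarrow> fm \<Rightarrow> fm" where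
  "ExOne z y p \<equiv> ExI z (AllI y (Iff p (IEq y z)))"

abbreviation AllIs :: "nat list \<Rightarrow> fm \<Rightarrow> fm" where
  "AllIs xs p \<equiv> foldr AllI xs p"

fun wf_fm :: "fm \<Rightarrow> bool" where
  "wf_fm (Pred n i xs) \<longleftrightarrow> n \<ge> 1 \<and> length xs = n"
| "wf_fm (IEq x y) \<longleftrightarrow> True"
| "wf_fm (PEq n i j) \<longleftrightarrow> n \<ge> 1"
| "wf_fm (Neg p) \<longleftrightarrow> wf_fm p"
| "wf_fm (Conj p q) \<longleftrightarrow> wf_fm p \<and> wf_fm q"
| "wf_fm (AllI x p) \<longleftrightarrow> wf_fm p"
| "wf_fm (AllP n i p) \<longleftrightarrow> n \<ge> 1 \<and> wf_fm p"

fun pred_vars :: "fm \<Rightarrow> (nat \<times> nat) set" where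
  "pred_vars (Pred n i xs) = {(n, i)}"
| "pred_vars (IEq x y) = {}"
| "pred_vars (PEq n i j) = {(n, i), (n, j)}"
| "pred_vars (Neg p) = pred_vars p"
| "pred_vars (Conj p q) = pred_vars p \<union> pred_vars q"
| "pred_vars (AllI x p) = pred_vars p"
| "pred_vars (AllP n i p) = insert (n, i) (pred_vars p)"

fun free_pred_vars :: "fm \<Rightarrow> (nat \<times> nat) set" where
  "free_pred_vars (Pred n i xs) = {(n, i)}"
| "free_pred_vars (IEq x y) = {}"
| "free_pred_vars (PEq n i j) = {(n, i), (n, j)}"
| "free_pred_vars (Neg p) = free_pred_vars p"
| "free_pred_vars (Conj p q) = free_pred_vars p \<union> free_pred_vars q"
| "free_pred_vars (AllI x p) = free_pred_vars p"
| "free_pred_vars (AllP n i p) = free_pred_vars p - {(n, i)}"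

text \<open>\<open>subst1 C B p\<close> replaces the free occurrences of the unary predicate variable \<open>C\<close> by \<open>B\<close>.
  It does not rename bound variables, so it is only used when \<open>B\<close> does not occur in \<open>p\<close>.\<close>

fun subst1 :: "nat \<Rightarrow> nat \<Rightarrow> fm \<Rightarrow> fm" where
  "subst1 C B (Pred n i xs) = Pred n (if n = 1 \<and> i = C then B else i) xs"
| "subst1 C B (IEq x y) = IEq x y"
| "subst1 C B (PEq n i j) =
     PEq n (if n = 1 \<and> i = C then B else i) (if n = 1 \<and> j = C then B else j)"
| "subst1 C B (Neg p) = Neg (subst1 C B p)"
| "subst1 C B (Conj p q) = Conj (subst1 C B p) (subst1 C B q)"
| "subst1 C B (AllI x p) = AllI x (subst1 C B p)"
| "subst1 C B (AllP n i p) = AllP n i (if n = 1 \<and> i = C then p else subst1 C B p)"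

text \<open>An \<open>n\<close>-ary predicate on \<open>D\<close> is represented by the set of those argument lists, of length \<open>n\<close>
  over \<open>D\<close>, at which it is true.\<close>

definition is_predicate :: "'a set \<Rightarrow> nat \<Rightarrow> 'a list set \<Rightarrow> bool" where
  "is_predicate D n \<alpha> \<longleftrightarrow> (\<forall>as\<in>\<alpha>. length as = n \<and> set as \<subseteq> D)"

text \<open>\<open>indiv\<close> is \<open>J\<^sub>0\<close>, and \<open>preds n\<close> is \<open>J\<^sub>n\<close> for \<open>n \<ge> 1\<close>; \<open>preds 0\<close> is irrelevant.\<close>

record 'a hstruct =
  indiv :: "'a set"
  preds :: "nat \<Rightarrow> 'a list set set"

definition assignment ::
  "'a hstruct \<Rightarrow> (nat \<Rightarrow> 'a) \<Rightarrow> (nat \<Rightarrow> nat \<Rightarrow> 'a list set) \<Rightarrow> bool" where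
  "assignment \<Sigma> v V \<longleftrightarrow> (\<forall>x. v x \<in> indiv \<Sigma>) \<and> (\<forall>n\<ge>1. \<forall>i. V n i \<in> preds \<Sigma> n)"

fun sat ::
  "'a hstruct \<Rightarrow> (nat \<Rightarrow> 'a) \<Rightarrow> (nat \<Rightarrow> nat \<Rightarrow> 'a list set) \<Rightarrow> fm \<Rightarrow> bool" where
  "sat \<Sigma> v V (Pred n i xs) \<longleftrightarrow> map v xs \<in> V n i"
| "sat \<Sigma> v V (IEq x y) \<longleftrightarrow> v x = v y"
| "sat \<Sigma> v V (PEq n i j) \<longleftrightarrow> V n i = V n j"
| "sat \<Sigma> v V (Neg p) \<longleftrightarrow> \<not> sat \<Sigma> v V p"
| "sat \<Sigma> v V (Conj p q) \<longleftrightarrow> sat \<Sigma> v V p \<and> sat \<Sigma> v V q"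
| "sat \<Sigma> v V (AllI x p) \<longleftrightarrow> (\<forall>a\<in>indiv \<Sigma>. sat \<Sigma> (v(x := a)) V p)"
| "sat \<Sigma> v V (AllP n i p) \<longleftrightarrow> (\<forall>\<alpha>\<in>preds \<Sigma> n. sat \<Sigma> v (V(n := (V n)(i := \<alpha>))) p)"

definition satisfies :: "'a hstruct \<Rightarrow> fm \<Rightarrow> bool" where
  "satisfies \<Sigma> p \<longleftrightarrow> (\<forall>v V. assignment \<Sigma> v V \<longrightarrow> sat \<Sigma> v V p)"

definition models :: "'a hstruct \<Rightarrow> fm set \<Rightarrow> bool" where
  "models \<Sigma> T \<longleftrightarrow> (\<forall>p\<in>T. satisfies \<Sigma> p)"

text \<open>\<open>definable \<Sigma> v V xs H\<close> is the predicate \<open>\<lambda>xs. H\<close>, with the parameters of \<open>H\<close> other than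
  \<open>xs\<close> given by the assignment.\<close>

definition definable ::
  "'a hstruct \<Rightarrow> (nat \<Rightarrow> 'a) \<Rightarrow> (nat \<Rightarrow> nat \<Rightarrow> 'a list set) \<Rightarrow> nat list \<Rightarrow> fm \<Rightarrow> 'a list set" where
  "definable \<Sigma> v V xs H =
     {map w xs | w. (\<forall>x\<in>set xs. w x \<in> indiv \<Sigma>) \<and> (\<forall>x. x \<notin> set xs \<longrightarrow> w x = v x) \<and> sat \<Sigma> w V H}"

text \<open>Nonemptiness of the \<open>J\<^sub>n\<close> is stated separately because there would otherwise be no assignments
  and the closure condition would be vacuous.\<close>

definition henkin_asser :: "'a hstruct \<Rightarrow> bool" where
  "henkin_asser \<Sigma> \<longleftrightarrow>
     indiv \<Sigma> \<noteq> {} \<and>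
     (\<forall>n\<ge>1. preds \<Sigma> n \<noteq> {} \<and> (\<forall>\<alpha>\<in>preds \<Sigma> n. is_predicate (indiv \<Sigma>) n \<alpha>)) \<and>
     (\<forall>H xs v V. wf_fm H \<and> xs \<noteq> [] \<and> distinct xs \<and> assignment \<Sigma> v V \<longrightarrow>
        definable \<Sigma> v V xs H \<in> preds \<Sigma> (length xs))"

definition comprehension :: "nat \<Rightarrow> nat list \<Rightarrow> fm \<Rightarrow> fm" where
  "comprehension A xs H = ExP (length xs) A (AllIs xs (Iff (Pred (length xs) A xs) H))"

definition extensionality :: "nat \<Rightarrow> nat \<Rightarrow> nat list \<Rightarrow> fm" where
  "extensionality A B xs =
     AllP (length xs) A (AllP (length xs) B
       (Imp (AllIs xs (Iff (Pred (length xs) A xs) (Pred (length xs) B xs)))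
            (PEq (length xs) A B)))"

text \<open>The non-logical axioms.  The axioms of many-sorted predicate logic with identity hold in every
  structure, since identity is interpreted as identity.\<close>

definition hax2 :: "fm set" where
  "hax2 =
     {comprehension A xs H | A xs H.
        wf_fm H \<and> xs \<noteq> [] \<and> distinct xs \<and> (length xs, A) \<notin> free_pred_vars H} \<union>
     {extensionality A B xs | A B xs. xs \<noteq> [] \<and> distinct xs \<and> A \<noteq> B}"

text \<open>\<open>A\<close> is \<open>(1, 0)\<close>, \<open>R\<close> is \<open>(2, 0)\<close>, \<open>S\<close> is \<open>(2, 1)\<close>; \<open>x\<close> is \<open>0\<close>, \<open>y\<close> is \<open>1\<close>.\<close>

definition AC11 :: fm where
  "AC11 =
     AllP 1 0 (AllP 2 0 (ExP 2 1
       (Imp (AllI 0 (Iff (Pred 1 0 [0]) (ExI 1 (Pred 2 0 [0, 1]))))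
            (AllI 0 (Imp (Pred 1 0 [0])
               (ExOne 2 1 (Conj (Pred 2 0 [0, 1]) (Pred 2 1 [0, 1]))))))))"

text \<open>Here \<open>y\<close> is the individual variable \<open>0\<close>; no occurrence of \<open>H\<close> is in the scope of an individual
  quantifier, so it may occur in \<open>H\<close>.\<close>

definition choice1 :: "fm \<Rightarrow> nat \<Rightarrow> nat \<Rightarrow> nat \<Rightarrow> nat \<Rightarrow> fm" where
  "choice1 H C C1 C2 D =
     Imp
       (Conj
         (AllP 1 C (Imp H (ExI 0 (Pred 1 C [0]))))
         (AllP 1 C1 (AllP 1 C2
           (Imp
             (Conj (Conj (subst1 C C1 H) (subst1 C C2 H))
                   (Neg (AllI 0 (Iff (Pred 1 C1 [0]) (Pred 1 C2 [0])))))
             (Neg (ExI 0 (Conj (Pred 1 C1 [0]) (Pred 1 C2 [0]))))))))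
       (ExP 1 D (AllP 1 C (Imp H (ExOne 1 0 (Conj (Pred 1 C [0]) (Pred 1 D [0]))))))"

definition choice1_vars :: "fm \<Rightarrow> nat \<Rightarrow> nat \<Rightarrow> nat \<Rightarrow> nat \<Rightarrow> bool" where
  "choice1_vars H C C1 C2 D \<longleftrightarrow>
     wf_fm H \<and> (1, C) \<in> free_pred_vars H \<and> distinct [C, C1, C2, D] \<and>
     (\<forall>B\<in>{C1, C2, D}. (1, B) \<notin> pred_vars H)"

definition choice_star1 :: "fm set" where
  "choice_star1 = {choice1 H C C1 C2 D | H C C1 C2 D. choice1_vars H C C1 C2 D}"

text \<open>\<open>perm_structure N G I\<close> is \<open>\<Sigma>(N, G, I)\<close>; the image under \<open>map \<pi>\<close> is the action of \<open>\<pi>\<close> on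
  predicates.\<close>

definition perm_structure :: "'a set \<Rightarrow> ('a \<Rightarrow> 'a) set \<Rightarrow> 'a set set \<Rightarrow> 'a hstruct" where
  "perm_structure N G I =
     \<lparr>indiv = N,
      preds = (\<lambda>n. {\<alpha>. is_predicate N n \<alpha> \<and>
        (\<exists>P\<in>I. \<forall>\<pi>\<in>G. (\<forall>x\<in>P. \<pi> x = x) \<longrightarrow> map \<pi> ` \<alpha> = \<alpha>)})\<rparr>"

definition Sigma0 :: "nat hstruct" where
  "Sigma0 = perm_structure UNIV {\<pi>. bij \<pi>} {P. finite P}"

end

theory Submission imports Defs "HOL-Combinatorics.Transposition" begin

text \<open>
  For an involution \<open>m\<close> of an infinite set, consider the permutation model with finite supports
  given by the bijections commuting with \<open>m\<close>.  If \<open>m\<close> is the identity, this is \<open>\<Sigma>\<^sub>0\<close>; if \<open>m\<close> has no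
  fixed point, it splits the individuals into interchangeable pairs \<open>{x, m x}\<close>.

  Both models satisfy \<open>AC\<^sup>1\<^sup>,\<^sup>1\<close>: if \<open>P\<close> supports \<open>R\<close>, then adding to \<open>P\<close> the mates of its points and two
  new points gives a finite \<open>P'\<close> such that every nonempty \<open>R x\<close> meets \<open>P' \<union> {x, m x}\<close>, and a choice
  from that set can be made in an invariant way.  In the model of pairs, a set with finite
  support cannot separate the two points of a pair away from its support, so the family of all pairs,
  definable from the relation \<open>y \<in> {x, m x}\<close>, has no choice set.  In \<open>\<Sigma>\<^sub>0\<close>, let a disjoint family of
  nonempty sets be definable with support \<open>P\<close>.  Members avoiding \<open>P\<close> are either all the
  singletons outside \<open>P\<close> or the single set \<open>-P\<close>, and at most \<open>|P|\<close> members meet \<open>P\<close>; so there is a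
  choice set that is finite or cofinite.
\<close>

section \<open>Henkin semantics\<close>

fun free_ind_vars :: "fm \<Rightarrow> nat set" where
  "free_ind_vars (Pred n i xs) = set xs"
| "free_ind_vars (IEq x y) = {x, y}"
| "free_ind_vars (PEq n i j) = {}"
| "free_ind_vars (Neg p) = free_ind_vars p"
| "free_ind_vars (Conj p q) = free_ind_vars p \<union> free_ind_vars q"
| "free_ind_vars (AllI x p) = free_ind_vars p - {x}"
| "free_ind_vars (AllP n i p) = free_ind_vars p"

lemma finite_free_ind_vars: "finite (free_ind_vars p)"
  by (induction p) auto

lemma finite_free_pred_vars: "finite (free_pred_vars p)"
  by (induction p) auto

lemma free_pred_vars_subset: "free_pred_vars p \<subseteq> pred_vars p"
  by (induction p) auto

lemma wf_fm_free_pred_vars: "wf_fm p \<Longrightarrow> (n, i) \<in> free_pred_vars p \<Longrightarrow> n \<ge> 1"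
  by (induction p) auto

lemma sat_cong:
  assumes "\<And>x. x \<in> free_ind_vars p \<Longrightarrow> v x = w x"
    and "\<And>n i. (n, i) \<in> free_pred_vars p \<Longrightarrow> V n i = W n i"
  shows "sat \<Sigma> v V p \<longleftrightarrow> sat \<Sigma> w W p"
  using assms
proof (induction p arbitrary: v w V W)
  case (Pred n i xs)
  have "map v xs = map w xs" using Pred.prems(1) by auto
  moreover have "V n i = W n i" using Pred.prems(2) by simp
  ultimately show ?case by (simp only: sat.simps)
next
  case (Conj p q)
  show ?case using Conj.IH[of v w V W] Conj.prems by simp
next
  case (AllI x p)
  have "sat \<Sigma> (v(x := a)) V p \<longleftrightarrow> sat \<Sigma> (w(x := a)) W p" for a
    by (rule AllI.IH) (use AllI.prems in auto)
  then show ?case by simp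
next
  case (AllP n i p)
  have "sat \<Sigma> v (V(n := (V n)(i := \<alpha>))) p \<longleftrightarrow> sat \<Sigma> w (W(n := (W n)(i := \<alpha>))) p" for \<alpha>
    by (rule AllP.IH) (use AllP.prems in auto)
  then show ?case by simp
next
  case (Neg p)
  show ?case using Neg.IH[of v w V W] Neg.prems by simp
qed simp_all

lemma sat_connectives:
  "sat \<Sigma> v V (Imp p q) \<longleftrightarrow> (sat \<Sigma> v V p \<longrightarrow> sat \<Sigma> v V q)"
  "sat \<Sigma> v V (Iff p q) \<longleftrightarrow> (sat \<Sigma> v V p \<longleftrightarrow> sat \<Sigma> v V q)"
  "sat \<Sigma> v V (ExI x p) \<longleftrightarrow> (\<exists>a\<in>indiv \<Sigma>. sat \<Sigma> (v(x := a)) V p)"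
  "sat \<Sigma> v V (ExP n i p) \<longleftrightarrow> (\<exists>\<alpha>\<in>preds \<Sigma> n. sat \<Sigma> v (V(n := (V n)(i := \<alpha>))) p)"
  by auto

lemma sat_AllIs:
  "sat \<Sigma> v V (AllIs xs p) \<longleftrightarrow>
     (\<forall>w. (\<forall>x\<in>set xs. w x \<in> indiv \<Sigma>) \<and> (\<forall>x. x \<notin> set xs \<longrightarrow> w x = v x) \<longrightarrow> sat \<Sigma> w V p)"
proof (induction xs arbitrary: v)
  case Nil
  have "(\<forall>x. w x = v x) \<longleftrightarrow> w = v" for w by auto
  then show ?case by simp
next
  case (Cons x xs)
  show ?case (is "?L \<longleftrightarrow> ?R")
  proof
    assume L: ?L
    show ?R
    proof (intro allI impI)
      fix w assume w: "(\<forall>y\<in>set (x # xs). w y \<in> indiv \<Sigma>) \<and> (\<forall>y. y \<notin> set (x # xs) \<longrightarrow> w y = v y)"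
      then have "sat \<Sigma> (v(x := w x)) V (AllIs xs p)" using L by simp
      then show "sat \<Sigma> w V p" unfolding Cons.IH using w by auto
    qed
  next
    assume R: ?R
    have "sat \<Sigma> (v(x := a)) V (AllIs xs p)" if "a \<in> indiv \<Sigma>" for a
      unfolding Cons.IH
    proof (intro allI impI)
      fix w assume w: "(\<forall>y\<in>set xs. w y \<in> indiv \<Sigma>) \<and> (\<forall>y. y \<notin> set xs \<longrightarrow> w y = (v(x := a)) y)"
      have "w x \<in> indiv \<Sigma>" using w that by (cases "x \<in> set xs") auto
      then show "sat \<Sigma> w V p" using R w by auto
    qed
    then show ?L by simp
  qed
qed

lemma sat_subst1:
  assumes "(1, B) \<notin> pred_vars p"
  shows "sat \<Sigma> v V (subst1 C B p) \<longleftrightarrow> sat \<Sigma> v (V(1 := (V 1)(C := V 1 B))) p"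
  using assms
proof (induction p arbitrary: v V)
  case (AllP n i p)
  show ?case
  proof (cases "n = 1 \<and> i = C")
    case False
    have "sat \<Sigma> v (V(n := (V n)(i := \<alpha>))) (subst1 C B p) \<longleftrightarrow>
        sat \<Sigma> v ((V(1 := (V 1)(C := V 1 B)))(n := ((V(1 := (V 1)(C := V 1 B))) n)(i := \<alpha>))) p" for \<alpha>
    proof -
      have "(V(n := (V n)(i := \<alpha>)))(1 := ((V(n := (V n)(i := \<alpha>))) 1)(C := (V(n := (V n)(i := \<alpha>))) 1 B))
          = (V(1 := (V 1)(C := V 1 B)))(n := ((V(1 := (V 1)(C := V 1 B))) n)(i := \<alpha>))"
        using False AllP.prems by (auto simp: fun_eq_iff)
      then show ?thesis
        using AllP.IH[of v "V(n := (V n)(i := \<alpha>))"] AllP.prems by (simp only: pred_vars.simps) blast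
    qed
    moreover have "subst1 C B (AllP n i p) = AllP n i (subst1 C B p)" using False by auto
    ultimately show ?thesis by (simp only: sat.simps)
  qed (simp only: subst1.simps sat.simps fun_upd_upd fun_upd_same simp_thms if_True)
qed auto

lemma hax2_henkin_asser:
  assumes "henkin_asser \<Sigma>"
  shows "models \<Sigma> hax2"
proof -
  have compr: "satisfies \<Sigma> (comprehension A xs H)"
    if "wf_fm H" "xs \<noteq> []" "distinct xs" "(length xs, A) \<notin> free_pred_vars H" for A xs H
    unfolding satisfies_def
  proof (intro allI impI)
    fix v V assume as: "assignment \<Sigma> v V"
    let ?\<alpha> = "definable \<Sigma> v V xs H"
    let ?W = "V(length xs := (V (length xs))(A := ?\<alpha>))"
    have mem: "?\<alpha> \<in> preds \<Sigma> (length xs)"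
      using assms that as unfolding henkin_asser_def by blast
    have "map w xs \<in> ?\<alpha> \<longleftrightarrow> sat \<Sigma> w ?W H"
      if w: "\<forall>x\<in>set xs. w x \<in> indiv \<Sigma>" "\<forall>x. x \<notin> set xs \<longrightarrow> w x = v x" for w
    proof -
      have "w' = w" if "map w xs = map w' xs" "\<forall>x. x \<notin> set xs \<longrightarrow> w' x = v x" for w'
        using that w(2) by (metis ext map_eq_conv)
      then have "map w xs \<in> ?\<alpha> \<longleftrightarrow> sat \<Sigma> w V H"
        unfolding definable_def using w by blast
      also have "\<dots> \<longleftrightarrow> sat \<Sigma> w ?W H"
        using that \<open>(length xs, A) \<notin> free_pred_vars H\<close> by (intro sat_cong) auto
      finally show ?thesis .
    qed
    then have "sat \<Sigma> v ?W (AllIs xs (Iff (Pred (length xs) A xs) H))"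
      unfolding sat_AllIs by auto
    then show "sat \<Sigma> v V (comprehension A xs H)"
      unfolding comprehension_def using mem by auto
  qed
  have ext: "satisfies \<Sigma> (extensionality A B xs)"
    if "xs \<noteq> []" "distinct xs" "A \<noteq> B" for A B xs
  proof -
    let ?n = "length xs"
    have sub: "\<alpha> \<subseteq> \<beta>" if \<alpha>: "\<alpha> \<in> preds \<Sigma> ?n"
      and eq: "\<And>w. (\<forall>x\<in>set xs. w x \<in> indiv \<Sigma>) \<Longrightarrow> (\<forall>x. x \<notin> set xs \<longrightarrow> w x = v x) \<Longrightarrow>
        map w xs \<in> \<alpha> \<Longrightarrow> map w xs \<in> \<beta>" for \<alpha> \<beta> v
    proof
      fix as assume as: "as \<in> \<alpha>"
      have "?n \<ge> 1" using \<open>xs \<noteq> []\<close> by (cases xs) auto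
      then have len: "length as = ?n" "set as \<subseteq> indiv \<Sigma>"
        using \<alpha> as assms unfolding henkin_asser_def is_predicate_def by auto
      define w where "w x = (case map_of (zip xs as) x of Some a \<Rightarrow> a | None \<Rightarrow> v x)" for x
      have w1: "w (xs ! k) = as ! k" if "k < ?n" for k
        using map_of_zip_nth[of xs as k] that len \<open>distinct xs\<close> by (simp add: w_def)
      have "map w xs = as" using w1 len by (intro nth_equalityI) auto
      moreover have "\<forall>x\<in>set xs. w x \<in> indiv \<Sigma>"
        using w1 len by (metis in_set_conv_nth nth_mem subsetD)
      moreover have "w x = v x" if "x \<notin> set xs" for x
        using that len by (simp add: w_def map_of_zip_is_None[THEN iffD2])
      ultimately show "as \<in> \<beta>" using eq[of w] as by auto
    qed
    have "\<alpha> = \<beta>" if "\<alpha> \<in> preds \<Sigma> ?n" "\<beta> \<in> preds \<Sigma> ?n"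
      and "\<forall>w. (\<forall>x\<in>set xs. w x \<in> indiv \<Sigma>) \<and> (\<forall>x. x \<notin> set xs \<longrightarrow> w x = v x) \<longrightarrow>
        (map w xs \<in> \<alpha> \<longleftrightarrow> map w xs \<in> \<beta>)" for \<alpha> \<beta> v
      using sub[of \<alpha> v \<beta>] sub[of \<beta> v \<alpha>] that by blast
    then have "sat \<Sigma> v (V(?n := (V ?n)(A := \<alpha>, B := \<beta>)))
        (Imp (AllIs xs (Iff (Pred ?n A xs) (Pred ?n B xs))) (PEq ?n A B))"
      if "\<alpha> \<in> preds \<Sigma> ?n" "\<beta> \<in> preds \<Sigma> ?n" for \<alpha> \<beta> v V
      using that \<open>A \<noteq> B\<close> by (simp add: sat_AllIs) blast
    then show ?thesis
      unfolding satisfies_def extensionality_def by (simp del: sat.simps(1-6))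
  qed
  show ?thesis
    unfolding models_def hax2_def using compr ext by auto
qed

lemma satisfies_AC11I:
  assumes "\<And>R. R \<in> preds \<Sigma> 2 \<Longrightarrow> \<exists>S\<in>preds \<Sigma> 2. \<forall>x\<in>indiv \<Sigma>. (\<exists>y\<in>indiv \<Sigma>. [x, y] \<in> R) \<longrightarrow>
    (\<exists>z\<in>indiv \<Sigma>. \<forall>y\<in>indiv \<Sigma>. [x, y] \<in> R \<and> [x, y] \<in> S \<longleftrightarrow> y = z)"
  shows "satisfies \<Sigma> AC11"
  unfolding satisfies_def AC11_def
proof (intro allI impI)
  fix v V assume "assignment \<Sigma> v V"
  show "sat \<Sigma> v V (AllP 1 0 (AllP 2 0 (ExP 2 1
       (Imp (AllI 0 (Iff (Pred 1 0 [0]) (ExI 1 (Pred 2 0 [0, 1]))))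
            (AllI 0 (Imp (Pred 1 0 [0])
               (ExOne 2 1 (Conj (Pred 2 0 [0, 1]) (Pred 2 1 [0, 1])))))))))"
    unfolding sat.simps(7)
  proof (intro ballI)
    fix \<alpha> R assume "\<alpha> \<in> preds \<Sigma> 1" "R \<in> preds \<Sigma> 2"
    then obtain S where S: "S \<in> preds \<Sigma> 2" and sel: "\<forall>x\<in>indiv \<Sigma>. (\<exists>y\<in>indiv \<Sigma>. [x, y] \<in> R) \<longrightarrow>
       (\<exists>z\<in>indiv \<Sigma>. \<forall>y\<in>indiv \<Sigma>. [x, y] \<in> R \<and> [x, y] \<in> S \<longleftrightarrow> y = z)"
      using assms by blast
    show "sat \<Sigma> v ((V(1 := (V 1)(0 := \<alpha>)))(2 := ((V(1 := (V 1)(0 := \<alpha>))) 2)(0 := R))) (ExP 2 1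
       (Imp (AllI 0 (Iff (Pred 1 0 [0]) (ExI 1 (Pred 2 0 [0, 1]))))
            (AllI 0 (Imp (Pred 1 0 [0])
               (ExOne 2 1 (Conj (Pred 2 0 [0, 1]) (Pred 2 1 [0, 1])))))))"
      (is "sat _ _ ?W (ExP 2 1 ?p)")
    proof -
      have "sat \<Sigma> v (?W(2 := (?W 2)(1 := S))) ?p"
        unfolding sat_connectives sat.simps(6) using sel by simp
      then show ?thesis using S unfolding sat_connectives by blast
    qed
  qed
qed

lemma sat_choice1_iff:
  assumes "choice1_vars H C C1 C2 D"
    and Q: "\<And>\<gamma>. Q \<gamma> \<longleftrightarrow> sat \<Sigma> v (V(1 := (V 1)(C := \<gamma>))) H"
  shows "sat \<Sigma> v V (choice1 H C C1 C2 D) \<longleftrightarrow>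
    ((\<forall>\<gamma>\<in>preds \<Sigma> 1. Q \<gamma> \<longrightarrow> (\<exists>y\<in>indiv \<Sigma>. [y] \<in> \<gamma>)) \<and>
     (\<forall>\<gamma>\<in>preds \<Sigma> 1. \<forall>\<gamma>'\<in>preds \<Sigma> 1. Q \<gamma> \<and> Q \<gamma>' \<and>
        \<not> (\<forall>y\<in>indiv \<Sigma>. [y] \<in> \<gamma> \<longleftrightarrow> [y] \<in> \<gamma>') \<longrightarrow> \<not> (\<exists>y\<in>indiv \<Sigma>. [y] \<in> \<gamma> \<and> [y] \<in> \<gamma>')) \<longrightarrow>
     (\<exists>\<delta>\<in>preds \<Sigma> 1. \<forall>\<gamma>\<in>preds \<Sigma> 1. Q \<gamma> \<longrightarrow>
        (\<exists>z\<in>indiv \<Sigma>. \<forall>y\<in>indiv \<Sigma>. [y] \<in> \<gamma> \<and> [y] \<in> \<delta> \<longleftrightarrow> y = z)))"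
proof -
  have d: "C \<noteq> C1" "C \<noteq> C2" "C \<noteq> D" "C1 \<noteq> C2" "C1 \<noteq> D" "C2 \<noteq> D"
    and n: "(1, C1) \<notin> pred_vars H" "(1, C2) \<notin> pred_vars H" "(1, D) \<notin> pred_vars H"
    using assms(1) unfolding choice1_vars_def by auto
  have nf: "(1, C1) \<notin> free_pred_vars H" "(1, C2) \<notin> free_pred_vars H" "(1, D) \<notin> free_pred_vars H"
    using n free_pred_vars_subset[of H] by blast+
  have s1: "sat \<Sigma> v (V(1 := (V 1)(C1 := \<gamma>, C2 := \<gamma>'))) (subst1 C C1 H) \<longleftrightarrow> Q \<gamma>" for \<gamma> \<gamma>'
    unfolding sat_subst1[OF n(1)] Q using d nf by (intro sat_cong) auto
  have s2: "sat \<Sigma> v (V(1 := (V 1)(C1 := \<gamma>, C2 := \<gamma>'))) (subst1 C C2 H) \<longleftrightarrow> Q \<gamma>'" for \<gamma> \<gamma>'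
    unfolding sat_subst1[OF n(2)] Q using d nf by (intro sat_cong) auto
  have s3: "sat \<Sigma> v (V(1 := (V 1)(D := \<delta>, C := \<gamma>))) H \<longleftrightarrow> Q \<gamma>" for \<delta> \<gamma>
    unfolding Q using d nf by (intro sat_cong) auto
  have s4: "sat \<Sigma> v (V(1 := (V 1)(C := \<gamma>))) H \<longleftrightarrow> Q \<gamma>" for \<gamma>
    unfolding Q ..
  have upd: "V(1 := (V 1)(C1 := \<gamma>), 1 := ((V(1 := (V 1)(C1 := \<gamma>))) 1)(C2 := \<gamma>'))
      = V(1 := (V 1)(C1 := \<gamma>, C2 := \<gamma>'))"
    "V(1 := (V 1)(D := \<gamma>), 1 := ((V(1 := (V 1)(D := \<gamma>))) 1)(C := \<gamma>'))
      = V(1 := (V 1)(D := \<gamma>, C := \<gamma>'))" for \<gamma> \<gamma>'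
    by simp_all
  show ?thesis
    unfolding choice1_def sat_connectives sat.simps(6,7)
    unfolding sat_connectives sat.simps upd s1 s2 s3 s4
    by (simp only: fun_upd_apply list.map d d[symmetric] if_False if_True simp_thms one_neq_zero,
        intro arg_cong2[where f = "(\<longrightarrow>)"] arg_cong2[where f = "(\<and>)"] ball_cong refl) blast+
qed

section \<open>Permutation structures with finite supports\<close>

lemma ball_image_fixed: "f ` A = A \<Longrightarrow> (\<forall>b\<in>A. Q b) \<longleftrightarrow> (\<forall>a\<in>A. Q (f a))"
  by (metis imageE imageI)

locale perm_group =
  fixes G :: "('a \<Rightarrow> 'a) set"
  assumes perm_bij: "\<pi> \<in> G \<Longrightarrow> bij \<pi>"
    and perm_comp: "\<pi> \<in> G \<Longrightarrow> \<sigma> \<in> G \<Longrightarrow> \<pi> \<circ> \<sigma> \<in> G"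
    and perm_inv: "\<pi> \<in> G \<Longrightarrow> inv \<pi> \<in> G"
begin

abbreviation "\<Sigma> \<equiv> perm_structure UNIV G {P. finite P}"

definition supports :: "'a set \<Rightarrow> 'a list set \<Rightarrow> bool" where
  "supports P \<alpha> \<longleftrightarrow> (\<forall>\<pi>\<in>G. (\<forall>x\<in>P. \<pi> x = x) \<longrightarrow> map \<pi> ` \<alpha> = \<alpha>)"

lemma indiv_perm_structure [simp]: "indiv \<Sigma> = UNIV"
  by (simp add: perm_structure_def)

lemma preds_iff: "\<alpha> \<in> preds \<Sigma> n \<longleftrightarrow> (\<forall>as\<in>\<alpha>. length as = n) \<and> (\<exists>P. finite P \<and> supports P \<alpha>)"
  by (auto simp: perm_structure_def is_predicate_def supports_def)

lemma inj_map_perm: "\<pi> \<in> G \<Longrightarrow> inj (map \<pi>)"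
  using perm_bij by (simp add: bij_is_inj)

lemma map_inv_perm:
  assumes "\<pi> \<in> G"
  shows "map \<pi> ` map (inv \<pi>) ` \<alpha> = \<alpha>" "map (inv \<pi>) ` map \<pi> ` \<alpha> = \<alpha>"
  using bij_is_surj[OF perm_bij[OF assms]] bij_is_inj[OF perm_bij[OF assms]]
  by (simp_all add: image_image surj_iff inj_iff)

lemma supportsI:
  assumes "\<And>\<pi> as. \<pi> \<in> G \<Longrightarrow> \<forall>x\<in>P. \<pi> x = x \<Longrightarrow> as \<in> \<alpha> \<Longrightarrow> map \<pi> as \<in> \<alpha>"
  shows "supports P \<alpha>"
  unfolding supports_def
proof (intro ballI impI)
  fix \<pi> assume \<pi>: "\<pi> \<in> G" "\<forall>x\<in>P. \<pi> x = x"
  then have "\<forall>x\<in>P. inv \<pi> x = x"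
    using perm_bij by (metis bij_inv_eq_iff)
  then have "map (inv \<pi>) ` \<alpha> \<subseteq> \<alpha>"
    using assms perm_inv[OF \<pi>(1)] by blast
  then have "\<alpha> \<subseteq> map \<pi> ` \<alpha>"
    using map_inv_perm(1)[OF \<pi>(1), of \<alpha>] by (metis image_mono)
  then show "map \<pi> ` \<alpha> = \<alpha>" using assms \<pi> by blast
qed

lemma supports_mem_iff:
  assumes "supports P \<alpha>" "\<pi> \<in> G" "\<forall>x\<in>P. \<pi> x = x"
  shows "map \<pi> as \<in> \<alpha> \<longleftrightarrow> as \<in> \<alpha>"
  using assms inj_map_perm[OF assms(2)] unfolding supports_def by (metis inj_image_mem_iff)

lemma supports_mono: "supports P \<alpha> \<Longrightarrow> P \<subseteq> P' \<Longrightarrow> supports P' \<alpha>"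
  unfolding supports_def by blast

lemma perm_preds:
  assumes "\<pi> \<in> G" "\<alpha> \<in> preds \<Sigma> n"
  shows "map \<pi> ` \<alpha> \<in> preds \<Sigma> n"
proof -
  obtain P where P: "finite P" "supports P \<alpha>" using assms preds_iff by blast
  have inj: "inj \<pi>" using perm_bij[OF assms(1)] bij_is_inj by blast
  have "supports (\<pi> ` P) (map \<pi> ` \<alpha>)"
  proof (rule supportsI)
    fix \<sigma> as assume \<sigma>: "\<sigma> \<in> G" "\<forall>x\<in>\<pi> ` P. \<sigma> x = x" and "as \<in> map \<pi> ` \<alpha>"
    then obtain bs where bs: "bs \<in> \<alpha>" "as = map \<pi> bs" by blast
    let ?\<tau> = "inv \<pi> \<circ> (\<sigma> \<circ> \<pi>)"
    have "?\<tau> \<in> G" by (intro perm_comp perm_inv assms \<sigma>)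
    moreover have "\<forall>x\<in>P. ?\<tau> x = x" using \<sigma> inj by simp
    ultimately have "map ?\<tau> bs \<in> \<alpha>" using P bs supports_mem_iff by blast
    moreover have "map \<sigma> as = map \<pi> (map ?\<tau> bs)"
      using bs bij_is_surj[OF perm_bij[OF assms(1)]] by (simp add: surj_f_inv_f)
    ultimately show "map \<sigma> as \<in> map \<pi> ` \<alpha>" by blast
  qed
  moreover have "\<forall>as\<in>map \<pi> ` \<alpha>. length as = n" using assms preds_iff by auto
  ultimately show ?thesis using P preds_iff by blast
qed

lemma sat_perm:
  assumes "\<pi> \<in> G"
  shows "sat \<Sigma> (\<pi> \<circ> v) (\<lambda>n i. map \<pi> ` V n i) p \<longleftrightarrow> sat \<Sigma> v V p"
proof (induction p arbitrary: v V)
  case (Pred n i xs)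
  have "map (\<pi> \<circ> v) xs \<in> map \<pi> ` V n i \<longleftrightarrow> map v xs \<in> V n i"
    using inj_image_mem_iff[OF inj_map_perm[OF assms]] by (metis map_map)
  then show ?case by (simp only: sat.simps)
next
  case (IEq x y)
  then show ?case using perm_bij[OF assms] by (simp add: bij_is_inj inj_eq)
next
  case (PEq n i j)
  then show ?case using inj_image_eq_iff[OF inj_map_perm[OF assms]] by simp
next
  case (AllI x p)
  have "(\<pi> \<circ> v)(x := \<pi> a) = \<pi> \<circ> v(x := a)" for a by auto
  then have eq: "sat \<Sigma> ((\<pi> \<circ> v)(x := \<pi> a)) (\<lambda>n i. map \<pi> ` V n i) p \<longleftrightarrow> sat \<Sigma> (v(x := a)) V p" for a
    by (simp only: AllI.IH)
  have im: "\<pi> ` indiv \<Sigma> = indiv \<Sigma>"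
    using bij_is_surj[OF perm_bij[OF assms]] by simp
  show ?case
    unfolding sat.simps by (rule trans[OF ball_image_fixed[OF im]]) (simp only: eq)
next
  case (AllP n i p)
  let ?W = "\<lambda>n i. map \<pi> ` V n i"
  have "?W(n := (?W n)(i := map \<pi> ` \<alpha>)) = (\<lambda>k j. map \<pi> ` (V(n := (V n)(i := \<alpha>))) k j)" for \<alpha>
    by (auto simp: fun_eq_iff)
  then have eq: "sat \<Sigma> (\<pi> \<circ> v) (?W(n := (?W n)(i := map \<pi> ` \<alpha>))) p
      \<longleftrightarrow> sat \<Sigma> v (V(n := (V n)(i := \<alpha>))) p" for \<alpha>
    by (simp only: AllP.IH)
  have im: "(\<lambda>\<beta>. map \<pi> ` \<beta>) ` preds \<Sigma> n = preds \<Sigma> n"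
  proof
    show "preds \<Sigma> n \<subseteq> (\<lambda>\<beta>. map \<pi> ` \<beta>) ` preds \<Sigma> n"
      using perm_preds[OF perm_inv[OF assms]] map_inv_perm(1)[OF assms, symmetric] by blast
  qed (use perm_preds[OF assms] in blast)
  show ?case
    unfolding sat.simps by (rule trans[OF ball_image_fixed[OF im]]) (simp only: eq)
next
  case (Neg p)
  show ?case by (simp only: sat.simps Neg.IH)
next
  case (Conj p q)
  show ?case by (simp only: sat.simps Conj.IH)
qed

text \<open>The truth of \<open>p\<close> is invariant when \<open>\<pi>\<close> is applied to the values of some variables only,
  provided that \<open>\<pi>\<close> fixes a finite set supporting the values of the others.\<close>

lemma sat_finite_support:
  assumes "wf_fm p" "assignment \<Sigma> v V"
  obtains P where "finite P"
    "\<forall>\<pi>\<in>G. (\<forall>x\<in>P. \<pi> x = x) \<longrightarrow> (\<forall>w w' W W'.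
      (\<forall>x. w' x = \<pi> (w x) \<or> w x = v x \<and> w' x = v x) \<longrightarrow>
      (\<forall>n i. W' n i = map \<pi> ` W n i \<or> W n i = V n i \<and> W' n i = V n i) \<longrightarrow>
      (sat \<Sigma> w' W' p \<longleftrightarrow> sat \<Sigma> w W p))"
proof -
  let ?F = "free_pred_vars p"
  have "\<exists>P. finite P \<and> supports P (V n i)" if "(n, i) \<in> ?F" for n i
    using assms wf_fm_free_pred_vars[OF assms(1) that] preds_iff unfolding assignment_def by blast
  then obtain S where S: "\<And>n i. (n, i) \<in> ?F \<Longrightarrow> finite (S n i) \<and> supports (S n i) (V n i)"
    by metis
  define P where "P = v ` free_ind_vars p \<union> (\<Union>(n, i)\<in>?F. S n i)"
  show thesis
  proof (rule that)
    show "finite P"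
      unfolding P_def using S finite_free_pred_vars finite_free_ind_vars by auto
  next
    show "\<forall>\<pi>\<in>G. (\<forall>x\<in>P. \<pi> x = x) \<longrightarrow> (\<forall>w w' W W'.
      (\<forall>x. w' x = \<pi> (w x) \<or> w x = v x \<and> w' x = v x) \<longrightarrow>
      (\<forall>n i. W' n i = map \<pi> ` W n i \<or> W n i = V n i \<and> W' n i = V n i) \<longrightarrow>
      (sat \<Sigma> w' W' p \<longleftrightarrow> sat \<Sigma> w W p))"
    proof (intro ballI allI impI)
      fix \<pi> w w' W W'
      assume \<pi>: "\<pi> \<in> G" "\<forall>x\<in>P. \<pi> x = x"
        and w: "\<forall>x. w' x = \<pi> (w x) \<or> w x = v x \<and> w' x = v x"
        and W: "\<forall>n i. W' n i = map \<pi> ` W n i \<or> W n i = V n i \<and> W' n i = V n i"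
      have "sat \<Sigma> w' W' p \<longleftrightarrow> sat \<Sigma> (\<pi> \<circ> w) (\<lambda>n i. map \<pi> ` W n i) p"
      proof (rule sat_cong)
        fix x assume "x \<in> free_ind_vars p"
        then have "\<pi> (v x) = v x" using \<pi> P_def by auto
        then show "w' x = (\<pi> \<circ> w) x" using w by (metis comp_apply)
      next
        fix n i assume ni: "(n, i) \<in> ?F"
        then have "\<forall>x\<in>S n i. \<pi> x = x" using \<pi> P_def by auto
        then have "map \<pi> ` V n i = V n i" using S[OF ni] \<pi> unfolding supports_def by blast
        then show "W' n i = map \<pi> ` W n i" using W by metis
      qed
      then show "sat \<Sigma> w' W' p \<longleftrightarrow> sat \<Sigma> w W p" by (simp only: sat_perm[OF \<pi>(1)])
    qed
  qed
qed

lemma henkin_asser_perm_structure: "henkin_asser \<Sigma>"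
  unfolding henkin_asser_def
proof (intro conjI allI impI)
  show "indiv \<Sigma> \<noteq> {}" by simp
  fix n :: nat
  have "{} \<in> preds \<Sigma> n" by (auto simp: preds_iff supports_def)
  then show "preds \<Sigma> n \<noteq> {}" by blast
  show "\<forall>\<alpha>\<in>preds \<Sigma> n. is_predicate (indiv \<Sigma>) n \<alpha>"
    by (simp add: preds_iff is_predicate_def)
next
  fix H v V and xs :: "nat list" assume "wf_fm H \<and> xs \<noteq> [] \<and> distinct xs \<and> assignment \<Sigma> v V"
  then have H: "wf_fm H" "assignment \<Sigma> v V" by auto
  obtain P where P: "finite P"
    and inv: "\<forall>\<pi>\<in>G. (\<forall>x\<in>P. \<pi> x = x) \<longrightarrow> (\<forall>w w' W W'.
      (\<forall>x. w' x = \<pi> (w x) \<or> w x = v x \<and> w' x = v x) \<longrightarrow>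
      (\<forall>n i. W' n i = map \<pi> ` W n i \<or> W n i = V n i \<and> W' n i = V n i) \<longrightarrow>
      (sat \<Sigma> w' W' H \<longleftrightarrow> sat \<Sigma> w W H))"
    by (rule sat_finite_support[OF H])
  have "supports P (definable \<Sigma> v V xs H)"
  proof (rule supportsI)
    fix \<pi> as assume \<pi>: "\<pi> \<in> G" "\<forall>x\<in>P. \<pi> x = x" and "as \<in> definable \<Sigma> v V xs H"
    then obtain w where w: "as = map w xs" "\<forall>x. x \<notin> set xs \<longrightarrow> w x = v x" "sat \<Sigma> w V H"
      unfolding definable_def by auto
    define w' where "w' x = (if x \<in> set xs then \<pi> (w x) else v x)" for x
    have "sat \<Sigma> w' V H \<longleftrightarrow> sat \<Sigma> w V H"
      by (rule inv[rule_format, OF \<pi>(1)]) (use \<pi>(2) w in \<open>auto simp: w'_def\<close>)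
    then have "sat \<Sigma> w' V H" using w by blast
    moreover have "map \<pi> as = map w' xs" by (simp add: w w'_def)
    moreover have "\<forall>x. x \<notin> set xs \<longrightarrow> w' x = v x" by (simp add: w'_def)
    ultimately show "map \<pi> as \<in> definable \<Sigma> v V xs H"
      unfolding definable_def by (simp only: indiv_perm_structure) blast
  qed
  then show "definable \<Sigma> v V xs H \<in> preds \<Sigma> (length xs)"
    using P by (auto simp: preds_iff definable_def)
qed

end

section \<open>Permutations commuting with an involution\<close>

locale mate =
  fixes m :: "'a \<Rightarrow> 'a"
  assumes mate_mate [simp]: "m (m x) = x"
    and mate_fixed: "m x = x \<longleftrightarrow> m y = y"
    and infinite_UNIV: "infinite (UNIV :: 'a set)"
begin

definition comm_perms :: "('a \<Rightarrow> 'a) set" where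
  "comm_perms = {\<pi>. bij \<pi> \<and> (\<forall>x. \<pi> (m x) = m (\<pi> x))}"

sublocale perm_group comm_perms
proof
  fix \<pi> \<sigma> assume \<pi>: "\<pi> \<in> comm_perms"
  then show "bij \<pi>" by (simp add: comm_perms_def)
  show "\<pi> \<circ> \<sigma> \<in> comm_perms" if "\<sigma> \<in> comm_perms"
    using \<pi> that by (simp add: comm_perms_def bij_comp)
  have "inv \<pi> (m x) = m (inv \<pi> x)" for x
  proof -
    have "\<pi> (m (inv \<pi> x)) = m x"
      using \<pi> by (simp add: comm_perms_def bij_is_surj surj_f_inv_f)
    then have "inv \<pi> (m x) = inv \<pi> (\<pi> (m (inv \<pi> x)))" by (rule arg_cong[OF sym])
    moreover have "inj \<pi>" using \<pi> by (simp add: comm_perms_def bij_is_inj)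
    ultimately show ?thesis by (simp only: inv_f_f)
  qed
  then show "inv \<pi> \<in> comm_perms" using \<pi> by (simp add: comm_perms_def bij_imp_bij_inv)
qed

definition swap_mates :: "'a \<Rightarrow> 'a \<Rightarrow> 'a \<Rightarrow> 'a" where
  "swap_mates y q z =
     (if z = y then q else if z = q then y else if z = m y then m q else if z = m q then m y else z)"

lemma swap_mates_in_comm_perms: "swap_mates y q \<in> comm_perms"
proof -
  have "swap_mates y q (swap_mates y q z) = z" for z
    using mate_fixed[of y q] unfolding swap_mates_def by (smt (verit) mate_mate)
  then have "bij (swap_mates y q)" by (metis involuntory_imp_bij)
  moreover have "swap_mates y q (m x) = m (swap_mates y q x)" for x
    using mate_fixed[of y q] unfolding swap_mates_def by (smt (verit) mate_mate)
  ultimately show ?thesis by (simp add: comm_perms_def)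
qed

lemma satisfies_AC11: "satisfies \<Sigma> AC11"
proof (rule satisfies_AC11I)
  fix R assume "R \<in> preds \<Sigma> 2"
  then obtain P where P: "finite P" "supports P R" using preds_iff by blast
  obtain q1 where q1: "q1 \<notin> P \<union> m ` P"
    using ex_new_if_finite[OF infinite_UNIV, of "P \<union> m ` P"] P(1) by auto
  obtain q2 where q2: "q2 \<notin> P \<union> m ` P \<union> {q1, m q1}"
    using ex_new_if_finite[OF infinite_UNIV, of "P \<union> m ` P \<union> {q1, m q1}"] P(1) by auto
  define P' where "P' = P \<union> m ` P \<union> {q1, q2}"
  have finP': "finite P'" and supP': "supports P' R"
    using P supports_mono[OF P(2), of P'] by (auto simp: P'_def)
  have near: "\<exists>y\<in>P'. [x, y] \<in> R" if "[x, y] \<in> R" "[x, x] \<notin> R" "[x, m x] \<notin> R" for x y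
  proof (cases "y \<in> P'")
    case False
    have y: "y \<noteq> x" "y \<noteq> m x" using that by auto
    obtain q where q: "q \<in> {q1, q2}" "q \<noteq> x" "q \<noteq> m x"
      using q2 by (metis Un_iff insertCI mate_mate)
    have "\<forall>z\<in>P. swap_mates y q z = z"
    proof
      fix z assume z: "z \<in> P"
      have "y \<noteq> z" "y \<noteq> m z" using False z by (auto simp: P'_def)
      moreover have "q \<noteq> z" "q \<noteq> m z" using q q1 q2 z by auto
      ultimately show "swap_mates y q z = z" unfolding swap_mates_def by (metis mate_mate)
    qed
    then have "map (swap_mates y q) [x, y] \<in> R"
      using supports_mem_iff[OF P(2) swap_mates_in_comm_perms] that by blast
    moreover have "swap_mates y q x = x"
      using y q unfolding swap_mates_def by (metis mate_mate)
    moreover have "swap_mates y q y = q" by (simp add: swap_mates_def)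
    ultimately show ?thesis using q by (auto simp: P'_def)
  qed (use that in auto)
  define f where "f x = (if [x, x] \<in> R then x else if [x, m x] \<in> R then m x
    else SOME y. y \<in> P' \<and> [x, y] \<in> R)" for x
  define S where "S = {[x, f x] | x. \<exists>y. [x, y] \<in> R}"
  have some: "(SOME y. y \<in> P' \<and> [x, y] \<in> R) \<in> P' \<and> [x, SOME y. y \<in> P' \<and> [x, y] \<in> R] \<in> R"
    if "[x, y] \<in> R" "[x, x] \<notin> R" "[x, m x] \<notin> R" for x y
    using someI_ex[of "\<lambda>y. y \<in> P' \<and> [x, y] \<in> R"] near[OF that] by blast
  have fR: "[x, f x] \<in> R" if "[x, y] \<in> R" for x y
    using some[OF that] by (auto simp: f_def)
  have "supports P' S"
  proof (rule supportsI)
    fix \<pi> as assume \<pi>: "\<pi> \<in> comm_perms" "\<forall>x\<in>P'. \<pi> x = x" and "as \<in> S"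
    then obtain x y where x: "as = [x, f x]" "[x, y] \<in> R" by (auto simp: S_def)
    have R: "[\<pi> a, \<pi> b] \<in> R \<longleftrightarrow> [a, b] \<in> R" for a b
      using supports_mem_iff[OF supP' \<pi>, of "[a, b]"] by simp
    have m: "m (\<pi> x) = \<pi> (m x)" using \<pi> by (simp add: comm_perms_def)
    have "(\<lambda>b. b \<in> P' \<and> [\<pi> x, b] \<in> R) = (\<lambda>b. b \<in> P' \<and> [x, b] \<in> R)"
      using R \<pi>(2) by (metis (no_types, opaque_lifting))
    then have "f (\<pi> x) = \<pi> (f x)"
      using some[OF x(2)] \<pi>(2) by (simp add: f_def R m)
    moreover have "[\<pi> x, \<pi> y] \<in> R" using R x by simp
    ultimately show "map \<pi> as \<in> S" by (auto simp: S_def x)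
  qed
  then have "S \<in> preds \<Sigma> 2" using finP' by (auto simp: preds_iff S_def)
  moreover have "\<exists>z. \<forall>y. [x, y] \<in> R \<and> [x, y] \<in> S \<longleftrightarrow> y = z" if "[x, y] \<in> R" for x y
  proof (intro exI[of _ "f x"] allI)
    fix z
    have "[x, z] \<in> S \<longleftrightarrow> z = f x" using that by (auto simp: S_def)
    then show "[x, z] \<in> R \<and> [x, z] \<in> S \<longleftrightarrow> z = f x" using fR[OF that] by blast
  qed
  ultimately show "\<exists>S\<in>preds \<Sigma> 2. \<forall>x\<in>indiv \<Sigma>. (\<exists>y\<in>indiv \<Sigma>. [x, y] \<in> R) \<longrightarrow>
    (\<exists>z\<in>indiv \<Sigma>. \<forall>y\<in>indiv \<Sigma>. [x, y] \<in> R \<and> [x, y] \<in> S \<longleftrightarrow> y = z)"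
    by (intro bexI[of _ S]) (simp only: indiv_perm_structure, blast)
qed

lemma models_hax2_AC11: "models \<Sigma> (hax2 \<union> {AC11})"
  using hax2_henkin_asser[OF henkin_asser_perm_structure] satisfies_AC11
  unfolding models_def by (simp only: ball_Un ball_simps(5,7) simp_thms)

end

section \<open>Failure of choice in the model of pairs\<close>

definition class_fm :: fm where
  "class_fm = ExI 1 (AllI 0 (Iff (Pred 1 0 [0]) (Pred 2 0 [1, 0])))"

lemma choice1_vars_class_fm: "choice1_vars class_fm 0 1 2 3"
  by (simp add: choice1_vars_def class_fm_def)

lemma (in mate) not_satisfies_choice1_class_fm:
  assumes "\<And>x. m x \<noteq> x"
  shows "\<not> satisfies \<Sigma> (choice1 class_fm 0 1 2 3)"
proof
  assume sat: "satisfies \<Sigma> (choice1 class_fm 0 1 2 3)"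
  define E where "E = {[x, y] | x y. y = x \<or> y = m x}"
  define V where "V n i = (if n = 2 then E else {})" for n i :: nat
  have "supports {} E"
    by (rule supportsI) (auto simp: E_def comm_perms_def)
  then have "E \<in> preds \<Sigma> 2" by (auto simp: preds_iff E_def)
  moreover have "{} \<in> preds \<Sigma> n" for n by (auto simp: preds_iff supports_def)
  ultimately have "assignment \<Sigma> (\<lambda>_. undefined) V"
    by (auto simp: assignment_def V_def)
  then have ch: "sat \<Sigma> (\<lambda>_. undefined) V (choice1 class_fm 0 1 2 3)"
    using sat by (auto simp: satisfies_def)
  have Q: "sat \<Sigma> (\<lambda>_. undefined) (V(1 := (V 1)(0 := \<gamma>))) class_fm \<longleftrightarrow>
      (\<exists>x. \<forall>y. [y] \<in> \<gamma> \<longleftrightarrow> y = x \<or> y = m x)" for \<gamma>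
    by (auto simp: class_fm_def V_def E_def)
  obtain \<delta> where \<delta>: "\<delta> \<in> preds \<Sigma> 1"
    and sel: "\<And>\<gamma> x. \<gamma> \<in> preds \<Sigma> 1 \<Longrightarrow> \<forall>y. [y] \<in> \<gamma> \<longleftrightarrow> y = x \<or> y = m x \<Longrightarrow>
      \<exists>z. \<forall>y. [y] \<in> \<gamma> \<and> [y] \<in> \<delta> \<longleftrightarrow> y = z"
  proof -
    let ?Q = "\<lambda>\<gamma>. \<exists>x. \<forall>y. [y] \<in> \<gamma> \<longleftrightarrow> y = x \<or> y = m x"
    have "\<forall>\<gamma>\<in>preds \<Sigma> 1. ?Q \<gamma> \<longrightarrow> (\<exists>y\<in>indiv \<Sigma>. [y] \<in> \<gamma>)"
      by auto
    moreover have "\<not> (\<exists>y\<in>indiv \<Sigma>. [y] \<in> \<gamma> \<and> [y] \<in> \<gamma>')"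
      if "?Q \<gamma> \<and> ?Q \<gamma>' \<and> \<not> (\<forall>y\<in>indiv \<Sigma>. [y] \<in> \<gamma> \<longleftrightarrow> [y] \<in> \<gamma>')" for \<gamma> \<gamma>'
      using that by (metis mate_mate)
    ultimately have "\<exists>\<delta>\<in>preds \<Sigma> 1. \<forall>\<gamma>\<in>preds \<Sigma> 1. ?Q \<gamma> \<longrightarrow>
        (\<exists>z\<in>indiv \<Sigma>. \<forall>y\<in>indiv \<Sigma>. [y] \<in> \<gamma> \<and> [y] \<in> \<delta> \<longleftrightarrow> y = z)"
      by (intro ch[unfolded sat_choice1_iff[OF choice1_vars_class_fm Q[symmetric]], rule_format]
          conjI ballI impI) blast+
    then obtain \<delta> where "\<delta> \<in> preds \<Sigma> 1" and "\<forall>\<gamma>\<in>preds \<Sigma> 1. ?Q \<gamma> \<longrightarrow>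
        (\<exists>z. \<forall>y. [y] \<in> \<gamma> \<and> [y] \<in> \<delta> \<longleftrightarrow> y = z)"
      unfolding indiv_perm_structure by auto
    then show thesis by (intro that[of \<delta>]) blast+
  qed
  obtain P where P: "finite P" "supports P \<delta>" using \<delta> preds_iff by blast
  obtain x where x: "x \<notin> P \<union> m ` P"
    using ex_new_if_finite[OF infinite_UNIV, of "P \<union> m ` P"] P(1) by auto
  let ?\<gamma> = "{[x], [m x]}"
  have "supports {x, m x} ?\<gamma>" by (rule supportsI) auto
  then have "?\<gamma> \<in> preds \<Sigma> 1" unfolding preds_iff by (intro conjI exI[of _ "{x, m x}"]) auto
  then obtain z where z: "\<And>y. [y] \<in> ?\<gamma> \<and> [y] \<in> \<delta> \<longleftrightarrow> y = z"
    using sel[of ?\<gamma> x] by auto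
  have "\<forall>y\<in>P. swap_mates x (m x) y = y"
    using x by (auto simp: swap_mates_def) (metis image_eqI mate_mate)+
  then have "[swap_mates x (m x) y] \<in> \<delta> \<longleftrightarrow> [y] \<in> \<delta>" for y
    using supports_mem_iff[OF P(2) swap_mates_in_comm_perms, of x "m x" "[y]"] by simp
  from this[of x] have "[m x] \<in> \<delta> \<longleftrightarrow> [x] \<in> \<delta>" by (simp add: swap_mates_def)
  then show False using z[of x] z[of "m x"] z[of z] assms[of x] by auto
qed

section \<open>Choice in the basic Fraenkel model\<close>

lemma choice_set_of_invariant_family:
  assumes P: "finite P"
    and inv: "\<And>\<pi> C. bij \<pi> \<Longrightarrow> \<forall>x\<in>P. \<pi> x = x \<Longrightarrow> C \<in> F \<Longrightarrow> \<pi> ` C \<in> F"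
    and ne: "\<And>C. C \<in> F \<Longrightarrow> C \<noteq> {}"
    and disj: "\<And>C C' x. C \<in> F \<Longrightarrow> C' \<in> F \<Longrightarrow> x \<in> C \<Longrightarrow> x \<in> C' \<Longrightarrow> C = C'"
  shows "\<exists>D. (finite D \<or> finite (- D)) \<and> (\<forall>C\<in>F. \<exists>z. C \<inter> D = {z})"
proof -
  define s where "s C = (SOME x. x \<in> C \<inter> P)" for C
  have s: "s C \<in> C \<inter> P" if "C \<inter> P \<noteq> {}" for C
    unfolding s_def using that by (meson ex_in_conv someI_ex)
  define D0 where "D0 = s ` {C \<in> F. C \<inter> P \<noteq> {}}"
  have D0: "D0 \<subseteq> P" using s by (auto simp: D0_def)
  then have fin0: "finite D0" using P finite_subset by blast
  have meet: "C \<inter> D0 = {s C}" if "C \<in> F" "C \<inter> P \<noteq> {}" for C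
  proof -
    have "s C' = s C" if "C' \<in> F" "C' \<inter> P \<noteq> {}" "s C' \<in> C" for C'
      using disj[OF \<open>C \<in> F\<close> that(1), of "s C'"] s[OF that(2)] that(3) by auto
    then have "C \<inter> D0 \<subseteq> {s C}" by (auto simp: D0_def)
    moreover have "s C \<in> C" "s C \<in> D0" using s[OF that(2)] that by (auto simp: D0_def)
    ultimately show ?thesis by blast
  qed
  show ?thesis
  proof (cases "\<exists>C\<in>F. C \<inter> P = {}")
    case False
    then show ?thesis using meet fin0 by blast
  next
    case True
    then obtain C0 q where C0: "C0 \<in> F" "C0 \<inter> P = {}" and q: "q \<in> C0" using ne by blast
    have move: "transpose y z ` C0 \<in> F" if "y \<in> C0" "z \<notin> P" for y z
    proof (rule inv)
      show "\<forall>x\<in>P. transpose y z x = x" using that C0 by (auto simp: transpose_def)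
    qed (use C0 in auto)
    show ?thesis
    proof (cases "C0 = {q}")
      case True
      have single: "{x} \<in> F" if "x \<notin> P" for x
        using move[OF q that] True by simp
      have "\<exists>z. C \<inter> (D0 \<union> - P) = {z}" if "C \<in> F" for C
      proof (cases "C \<inter> P = {}")
        case True
        obtain x where x: "x \<in> C" using ne \<open>C \<in> F\<close> by blast
        then have "C = {x}" using disj[OF that single, of x x] True by auto
        then show ?thesis using x True by auto
      next
        case False
        have "C \<subseteq> P"
        proof
          fix x assume "x \<in> C"
          then show "x \<in> P" using disj[OF that single, of x x] False by auto
        qed
        then have "C \<inter> (D0 \<union> - P) = C \<inter> D0" by auto
        then show ?thesis using meet[OF that False] by auto
      qed
      moreover have "finite (- (D0 \<union> - P))" using P by (simp add: finite_subset)
      ultimately show ?thesis by blast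
    next
      case False
      then obtain y where y: "y \<in> C0" "y \<noteq> q" using q by blast
      have all: "z \<in> C0" if "z \<notin> P" for z
      proof (rule ccontr)
        assume z: "z \<notin> C0"
        have "q = transpose y z q" using z q y by (auto simp: transpose_def)
        then have "q \<in> transpose y z ` C0" using q by (metis image_eqI)
        then have "C0 = transpose y z ` C0" using disj[OF C0(1) move[OF y(1) that] q] by blast
        then show False using y z by (metis image_eqI transpose_apply_first)
      qed
      have "\<exists>z. C \<inter> insert q D0 = {z}" if "C \<in> F" for C
      proof (cases "C \<inter> P = {}")
        case True
        obtain x where "x \<in> C" using ne \<open>C \<in> F\<close> by blast
        then have "C = C0" using disj[OF that C0(1), of x] all True by auto
        then show ?thesis using q D0 C0(2) by auto
      next
        case False
        then have "q \<notin> C" using disj[OF that C0(1), of q] q C0(2) by auto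
        then show ?thesis using meet[OF that False] by auto
      qed
      then show ?thesis using fin0 by (metis finite_insert)
    qed
  qed
qed

interpretation id_mate: mate "id :: nat \<Rightarrow> nat"
  by unfold_locales auto

lemma Sigma0_eq: "Sigma0 = id_mate.\<Sigma>"
  by (simp add: Sigma0_def id_mate.comm_perms_def)

lemma satisfies_choice1_Sigma0:
  assumes "choice1_vars H C C1 C2 D"
  shows "satisfies Sigma0 (choice1 H C C1 C2 D)"
  unfolding satisfies_def
proof (intro allI impI)
  fix v V assume as: "assignment Sigma0 v V"
  define Q where "Q \<gamma> \<longleftrightarrow> sat Sigma0 v (V(1 := (V 1)(C := \<gamma>))) H" for \<gamma>
  define F where "F = {{x. [x] \<in> \<gamma>} | \<gamma>. \<gamma> \<in> preds Sigma0 1 \<and> Q \<gamma>}"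
  have [simp]: "indiv Sigma0 = UNIV" by (simp add: Sigma0_eq)
  have wf: "wf_fm H" using assms by (simp add: choice1_vars_def)
  obtain P where P: "finite P"
    and inv: "\<forall>\<pi>\<in>id_mate.comm_perms. (\<forall>x\<in>P. \<pi> x = x) \<longrightarrow> (\<forall>w w' W W'.
      (\<forall>x. w' x = \<pi> (w x) \<or> w x = v x \<and> w' x = v x) \<longrightarrow>
      (\<forall>n i. W' n i = map \<pi> ` W n i \<or> W n i = V n i \<and> W' n i = V n i) \<longrightarrow>
      (sat Sigma0 w' W' H \<longleftrightarrow> sat Sigma0 w W H))"
    by (rule id_mate.sat_finite_support[OF wf as[unfolded Sigma0_eq], folded Sigma0_eq])
  have F_inv: "\<pi> ` A \<in> F" if \<pi>: "bij \<pi>" "\<forall>x\<in>P. \<pi> x = x" and "A \<in> F" for \<pi> A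
  proof -
    obtain \<gamma> where \<gamma>: "A = {x. [x] \<in> \<gamma>}" "\<gamma> \<in> preds Sigma0 1" "Q \<gamma>"
      using \<open>A \<in> F\<close> by (auto simp: F_def)
    have G: "\<pi> \<in> id_mate.comm_perms" using \<pi> by (simp add: id_mate.comm_perms_def)
    have "map \<pi> ` \<gamma> \<in> preds Sigma0 1"
      using id_mate.perm_preds[OF G] \<gamma>(2) by (simp add: Sigma0_eq)
    moreover have "Q (map \<pi> ` \<gamma>) \<longleftrightarrow> Q \<gamma>"
      unfolding Q_def by (rule inv[rule_format, OF G]) (use \<pi>(2) in auto)
    then have "Q (map \<pi> ` \<gamma>)" using \<gamma>(3) by blast
    moreover have "\<pi> ` A = {x. [x] \<in> map \<pi> ` \<gamma>}"
      by (auto simp: \<gamma>(1) image_iff) (metis list.simps(8,9))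
    ultimately show ?thesis by (auto simp: F_def)
  qed
  show "sat Sigma0 v V (choice1 H C C1 C2 D)"
    unfolding sat_choice1_iff[where Q = Q, OF assms Q_def]
  proof (intro impI, elim conjE)
    assume ne: "\<forall>\<gamma>\<in>preds Sigma0 1. Q \<gamma> \<longrightarrow> (\<exists>y\<in>indiv Sigma0. [y] \<in> \<gamma>)"
      and disj: "\<forall>\<gamma>\<in>preds Sigma0 1. \<forall>\<gamma>'\<in>preds Sigma0 1. Q \<gamma> \<and> Q \<gamma>' \<and>
        \<not> (\<forall>y\<in>indiv Sigma0. [y] \<in> \<gamma> \<longleftrightarrow> [y] \<in> \<gamma>') \<longrightarrow>
        \<not> (\<exists>y\<in>indiv Sigma0. [y] \<in> \<gamma> \<and> [y] \<in> \<gamma>')"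
    have "\<exists>D. (finite D \<or> finite (- D)) \<and> (\<forall>A\<in>F. \<exists>z. A \<inter> D = {z})"
    proof (rule choice_set_of_invariant_family[OF P F_inv])
      show "A \<noteq> {}" if "A \<in> F" for A using ne that by (auto simp: F_def)
      show "A = A'" if A: "A \<in> F" "A' \<in> F" "x \<in> A" "x \<in> A'" for A A' x
      proof -
        obtain \<gamma> \<gamma>' where \<gamma>: "A = {x. [x] \<in> \<gamma>}" "\<gamma> \<in> preds Sigma0 1" "Q \<gamma>"
          and \<gamma>': "A' = {x. [x] \<in> \<gamma>'}" "\<gamma>' \<in> preds Sigma0 1" "Q \<gamma>'"
          using A(1,2) by (auto simp: F_def)
        have "\<forall>y\<in>indiv Sigma0. [y] \<in> \<gamma> \<longleftrightarrow> [y] \<in> \<gamma>'"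
        proof (rule ccontr)
          assume "\<not> (\<forall>y\<in>indiv Sigma0. [y] \<in> \<gamma> \<longleftrightarrow> [y] \<in> \<gamma>')"
          then have "\<not> (\<exists>y\<in>indiv Sigma0. [y] \<in> \<gamma> \<and> [y] \<in> \<gamma>')"
            by (intro disj[rule_format] conjI \<gamma> \<gamma>')
          then show False using A(3,4) \<gamma>(1) \<gamma>'(1) by simp
        qed
        then show ?thesis using \<gamma>(1) \<gamma>'(1) by simp
      qed
    qed
    then obtain D where D: "finite D \<or> finite (- D)" "\<forall>A\<in>F. \<exists>z. A \<inter> D = {z}" by blast
    let ?\<delta> = "(\<lambda>x. [x]) ` D"
    have "id_mate.supports D ?\<delta>" by (rule id_mate.supportsI) auto
    moreover have "id_mate.supports (- D) ?\<delta>"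
    proof (rule id_mate.supportsI)
      fix \<pi> as assume \<pi>: "\<pi> \<in> id_mate.comm_perms" "\<forall>x\<in>- D. \<pi> x = x" and "as \<in> ?\<delta>"
      then obtain x where x: "as = [x]" "x \<in> D" by blast
      have "inj \<pi>" using \<pi> by (simp add: id_mate.comm_perms_def bij_is_inj)
      then have "\<pi> x \<in> D" using \<pi>(2) x(2) by (metis ComplI injD)
      then show "map \<pi> as \<in> ?\<delta>" by (simp add: x)
    qed
    ultimately have "?\<delta> \<in> preds Sigma0 1"
      using D(1) by (auto simp: Sigma0_eq id_mate.preds_iff)
    moreover have "\<exists>z. \<forall>y. [y] \<in> \<gamma> \<and> [y] \<in> ?\<delta> \<longleftrightarrow> y = z"
      if "\<gamma> \<in> preds Sigma0 1" "Q \<gamma>" for \<gamma>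
    proof -
      have "{x. [x] \<in> \<gamma>} \<in> F" using that by (auto simp: F_def)
      then obtain z where "{x. [x] \<in> \<gamma>} \<inter> D = {z}" using D(2) by blast
      then show ?thesis by (intro exI[of _ z]) (auto simp: image_iff set_eq_iff)
    qed
    ultimately show "\<exists>\<delta>\<in>preds Sigma0 1. \<forall>\<gamma>\<in>preds Sigma0 1. Q \<gamma> \<longrightarrow>
        (\<exists>z\<in>indiv Sigma0. \<forall>y\<in>indiv Sigma0. [y] \<in> \<gamma> \<and> [y] \<in> \<delta> \<longleftrightarrow> y = z)"
      by auto
  qed
qed

theorem theorem3p1:
  "(\<exists>H C C1 C2 D. choice1_vars H C C1 C2 D \<and>
      (\<exists>\<Sigma> :: nat hstruct. henkin_asser \<Sigma> \<and> models \<Sigma> (hax2 \<union> {AC11}) \<and>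
         \<not> satisfies \<Sigma> (choice1 H C C1 C2 D))) \<and>
   henkin_asser Sigma0 \<and> models Sigma0 (hax2 \<union> choice_star1 \<union> {AC11})"
proof -
  let ?m = "\<lambda>n :: nat. if even n then n + 1 else n - 1"
  interpret pairs: mate ?m
    by unfold_locales (auto elim: oddE)
  have "?m x \<noteq> x" for x by (auto elim: oddE)
  then have "\<not> satisfies pairs.\<Sigma> (choice1 class_fm 0 1 2 3)"
    using pairs.not_satisfies_choice1_class_fm by blast
  moreover have "models Sigma0 (hax2 \<union> choice_star1 \<union> {AC11})"
    using id_mate.models_hax2_AC11 satisfies_choice1_Sigma0
    by (auto simp: models_def choice_star1_def Sigma0_eq)
  ultimately show ?thesis
    using choice1_vars_class_fm pairs.henkin_asser_perm_structure pairs.models_hax2_AC11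
      id_mate.henkin_asser_perm_structure unfolding Sigma0_eq by blast
qed

end
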